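(* For every integer $n$ with $3\leq n\leq 9$, $\tau(C_n)=\beta(C_n)$. Equivalently, for $3\leq n\leq 9$ and $t$ a non-negative integer, $C_n\cup tP_3$ is antimagic if and only if $$0\leq t\leq\left\lfloor(1+\sqrt{2})\left(n+\tfrac{1}{2}\right)\right\rfloor.$$
   Context: Graphs are finite and simple, not necessarily connected. For a graph $G$ with $m$ edges and a bijection $f: E(G)\to\{1,2,\dots,m\}$, let $\phi_f(v)$ be the sum of $f(e)$ over all edges $e$ incident to the vertex $v$. The bijection $f$ is an antimagic labeling of $G$ if $\phi_f(u)\neq\phi_f(v)$ for all pairs of distinct vertices $u,v$; $G$ is antimagic if it admits an antimagic labeling. $P_j$ is the path on $j$ vertices, $C_j$ the cycle on $j$ vertices. $G\cup H$ denotes disjoint union, and $tG$ the disjoint union of $t$ copies of $G$. If $G$ is antimagic, $\tau(G)$ is the maximum non-negative integer $t$ such that $G\cup t'P_3$ is antimagic for all integers $0\leq t'\leq t$; if $G$ is not antimagic, $\tau(G)=-\infty$. An edge is internal if both of its ends are non-leaf vertices. For a graph $G$ without isolated vertices and without $P_2$ as a component, having $n$ vertices, $m$ edges, $k$ internal edges, and $t'$ components isomorphic to $P_3$, $$\beta(G) = \left\lfloor\min \left\{ (3 + 2\sqrt{2})(m -n)+(1 + \sqrt{2})\left(m +\tfrac{1}{2}\right), \ 2m + 5(k-t') +1 \right\} \right\rfloor.$$ *)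

theory Defs
  imports Complex_Main "HOL-Library.Extended_Real"
begin

datatype 'a graph = Graph (verts: "'a set") (edges: "'a set set")

definition finite_simple :: "'a graph \<Rightarrow> bool" where
  "finite_simple G \<longleftrightarrow>
     finite (verts G) \<and> (\<forall>e\<in>edges G. e \<subseteq> verts G \<and> card e = 2)"

definition degree :: "'a graph \<Rightarrow> 'a \<Rightarrow> nat" where
  "degree G v = card {e \<in> edges G. v \<in> e}"

definition leaf :: "'a graph \<Rightarrow> 'a \<Rightarrow> bool" where
  "leaf G v \<longleftrightarrow> v \<in> verts G \<and> degree G v = 1"

definition internal_edges :: "'a graph \<Rightarrow> 'a set set" where
  "internal_edges G = {e \<in> edges G. \<forall>v\<in>e. \<not> leaf G v}"

definition isomorphic :: "'a graph \<Rightarrow> 'b graph \<Rightarrow> bool" where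
  "isomorphic G H \<longleftrightarrow>
     (\<exists>h. bij_betw h (verts G) (verts H) \<and>
          (\<forall>u\<in>verts G. \<forall>v\<in>verts G. {u, v} \<in> edges G \<longleftrightarrow> {h u, h v} \<in> edges H))"

definition reachable :: "'a graph \<Rightarrow> 'a \<Rightarrow> 'a \<Rightarrow> bool" where
  "reachable G = (\<lambda>u v. {u, v} \<in> edges G)\<^sup>*\<^sup>*"

definition induced :: "'a graph \<Rightarrow> 'a set \<Rightarrow> 'a graph" where
  "induced G X = Graph X {e \<in> edges G. e \<subseteq> X}"

definition components :: "'a graph \<Rightarrow> 'a graph set" where
  "components G = (\<lambda>u. induced G {v \<in> verts G. reachable G u v}) ` verts G"

definition path :: "nat \<Rightarrow> nat graph" where
  "path j = Graph {..<j} {{i, Suc i} | i. Suc i < j}"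

text \<open>The definition yields the cycle only for at least three vertices.\<close>

definition cycle :: "nat \<Rightarrow> nat graph" where
  "cycle j = Graph {..<j} {{i, Suc i mod j} | i. i < j}"

definition disjoint_union :: "'a graph \<Rightarrow> 'b graph \<Rightarrow> ('a + 'b) graph" where
  "disjoint_union G H =
     Graph (verts G <+> verts H) ((`) Inl ` edges G \<union> (`) Inr ` edges H)"

definition copies :: "nat \<Rightarrow> 'a graph \<Rightarrow> (nat \<times> 'a) graph" where
  "copies t G = Graph ({..<t} \<times> verts G) (\<Union>i<t. (`) (Pair i) ` edges G)"

definition vertex_sum :: "'a graph \<Rightarrow> ('a set \<Rightarrow> nat) \<Rightarrow> 'a \<Rightarrow> nat" where
  "vertex_sum G f v = (\<Sum>e | e \<in> edges G \<and> v \<in> e. f e)"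

definition antimagic_labeling :: "'a graph \<Rightarrow> ('a set \<Rightarrow> nat) \<Rightarrow> bool" where
  "antimagic_labeling G f \<longleftrightarrow>
     bij_betw f (edges G) {1..card (edges G)} \<and>
     (\<forall>u\<in>verts G. \<forall>v\<in>verts G. u \<noteq> v \<longrightarrow> vertex_sum G f u \<noteq> vertex_sum G f v)"

definition antimagic :: "'a graph \<Rightarrow> bool" where
  "antimagic G \<longleftrightarrow> (\<exists>f. antimagic_labeling G f)"

text \<open>The maximum exists for every finite simple graph that is antimagic: its unions with
  sufficiently many paths on three vertices are not antimagic.\<close>

definition tau :: "'a graph \<Rightarrow> ereal" where
  "tau G =
     (if antimagic G
      then ereal (real (GREATEST t. \<forall>t'\<le>t. antimagic (disjoint_union G (copies t' (path 3)))))
      else -\<infinity>)"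

text \<open>Meant for finite simple graphs without isolated vertices and without components
  isomorphic to the path on two vertices.\<close>

definition beta :: "'a graph \<Rightarrow> int" where
  "beta G =
     (let n = real (card (verts G));
          m = real (card (edges G));
          k = real (card (internal_edges G));
          t' = real (card {C \<in> components G. isomorphic C (path 3)})
      in \<lfloor>min ((3 + 2 * sqrt 2) * (m - n) + (1 + sqrt 2) * (m + 1 / 2))
              (2 * m + 5 * (k - t') + 1)\<rfloor>)"

lemma finite_simple_path: "finite_simple (path j)"
  by (auto simp: finite_simple_def path_def)

lemma finite_simple_cycle:
  assumes "3 \<le> j"
  shows "finite_simple (cycle j)"
proof -
  have "i \<noteq> Suc i mod j" if "i < j" for i
    using that assms by (cases "Suc i = j") auto
  then show ?thesis
    using assms by (auto simp: finite_simple_def cycle_def)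
qed

lemma finite_simple_disjoint_union:
  assumes "finite_simple G" "finite_simple H"
  shows "finite_simple (disjoint_union G H)"
  using assms by (auto simp: finite_simple_def disjoint_union_def card_image)

lemma finite_simple_copies:
  assumes "finite_simple G"
  shows "finite_simple (copies t G)"
  using assms by (auto simp: finite_simple_def copies_def card_image inj_on_def)

end

theory Submission
  imports Defs
begin

text \<open>
  Let \<open>V\<close> be the number of vertices and \<open>m\<close> the number of edges of a graph without isolated
  vertices. In an antimagic labeling the vertex sums are \<open>V\<close> distinct positive integers, so they add
  up to at least \<open>V (V + 1) / 2\<close>. Every label counts at both ends of its edge, so they add up to
  exactly \<open>m (m + 1)\<close>. Hence \<open>V (V + 1) \<le> 2 m (m + 1)\<close> (\<open>antimagic_order_size_bound\<close>). Each added
  path on three vertices raises \<open>V\<close> by three but \<open>m\<close> only by two, so the inequality limits the number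
  \<open>t\<close> of paths. For a cycle with \<open>n\<close> vertices, \<open>V = n + 3 t\<close> and \<open>m = n + 2 t\<close>, and it becomes
  \<open>t\<^sup>2 \<le> (2 n + 1) t + n (n + 1)\<close>. The positive root of the quadratic is not quite
  \<open>(1 + sqrt 2) (n + 1 / 2)\<close>, but no integer separates the two (\<open>le_floor_iff_quadratic\<close>).

  For \<open>3 \<le> n \<le> 9\<close> every \<open>t\<close> that satisfies the inequality is realised by an explicit labeling.
  There are 113 pairs \<open>(n, t)\<close>, and \<open>antimagic_if_labeling_certificate\<close> reduces each of them to a
  computation with lists: the labels around the cycle, and the pair of labels on each path.

  A cycle has as many edges as vertices, all its edges are internal, and it has no component
  isomorphic to a path, which turns \<open>beta\<close> into the floor of
  \<open>(1 + sqrt 2) (n + 1 / 2)\<close> (\<open>beta_cycle\<close>).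
\<close>

section \<open>The counting bound\<close>

text \<open>The set \<open>{1..card A}\<close> has the least sum. In the induction the maximum is removed: it is at least
  \<open>card A\<close> because \<open>A\<close> is contained in \<open>{1..Max A}\<close>.\<close>

lemma sum_of_distinct_positives_ge:
  fixes A :: "nat set"
  assumes "finite A" "0 \<notin> A"
  shows "card A * (card A + 1) \<le> 2 * \<Sum>A"
  using assms
proof (induction "card A" arbitrary: A)
  case 0
  then show ?case by simp
next
  case (Suc k)
  let ?M = "Max A"
  have ne: "A \<noteq> {}" using Suc.hyps(2) by auto
  have M: "?M \<in> A" using ne Suc.prems(1) by simp
  have "A \<subseteq> {1..?M}"
    using Suc.prems by (auto simp: Suc_le_eq intro: gr0I)
  then have M_ge: "Suc k \<le> ?M"
    using card_mono[of "{1..?M}" A] Suc.hyps(2) by simp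
  have card: "card (A - {?M}) = k"
    using M Suc.hyps(2) Suc.prems(1) by simp
  have "k * (k + 1) \<le> 2 * \<Sum>(A - {?M})"
    using Suc.hyps(1)[of "A - {?M}"] card Suc.prems by simp
  moreover have "\<Sum>A = ?M + \<Sum>(A - {?M})"
    using M Suc.prems(1) by (simp add: sum.remove)
  ultimately show ?case
    using M_ge Suc.hyps(2)[symmetric] by (simp add: algebra_simps)
qed

lemma finite_simple_imp_finite: "finite_simple G \<Longrightarrow> finite (verts G)"
  by (simp add: finite_simple_def)

lemma finite_edges:
  assumes "finite_simple G"
  shows "finite (edges G)"
proof (rule finite_subset)
  show "edges G \<subseteq> Pow (verts G)" "finite (Pow (verts G))"
    using assms by (auto simp: finite_simple_def)
qed

text \<open>The weighted handshake lemma.\<close>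

lemma sum_vertex_sum:
  assumes "finite_simple G"
  shows "(\<Sum>v\<in>verts G. vertex_sum G f v) = 2 * (\<Sum>e\<in>edges G. f e)"
proof -
  have "(\<Sum>v\<in>verts G. vertex_sum G f v) = (\<Sum>e\<in>edges G. \<Sum>v | v \<in> verts G \<and> v \<in> e. f e)"
    unfolding vertex_sum_def
    using assms finite_edges[OF assms] by (intro sum.swap_restrict) (auto simp: finite_simple_def)
  also have "\<dots> = (\<Sum>e\<in>edges G. 2 * f e)"
  proof (rule sum.cong)
    fix e assume "e \<in> edges G"
    then have "{v. v \<in> verts G \<and> v \<in> e} = e" "card e = 2"
      using assms by (auto simp: finite_simple_def)
    then show "(\<Sum>v | v \<in> verts G \<and> v \<in> e. f e) = 2 * f e" by simp
  qed simp
  finally show ?thesis by (simp add: sum_distrib_left)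
qed

text \<open>Both sides bracket twice the total of the vertex sums: they are distinct, and they are positive
  because every vertex lies on an edge; and the labels add up to \<open>1 + \<dots> + m\<close>.\<close>

lemma antimagic_order_size_bound:
  assumes G: "finite_simple G" and cover: "verts G \<subseteq> \<Union>(edges G)" and "antimagic G"
  shows "card (verts G) * (card (verts G) + 1) \<le> 2 * (card (edges G) * (card (edges G) + 1))"
proof -
  obtain f where f: "bij_betw f (edges G) {1..card (edges G)}"
    and inj: "inj_on (vertex_sum G f) (verts G)"
    using \<open>antimagic G\<close> unfolding antimagic_def antimagic_labeling_def inj_on_def by blast
  have fin: "finite (verts G)" using G by (simp add: finite_simple_def)
  have pos: "vertex_sum G f v \<noteq> 0" if v: "v \<in> verts G" for v
  proof -
    obtain e where e: "e \<in> edges G" "v \<in> e" using cover v by blast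
    then have "f e \<noteq> 0" using bij_betwE[OF f] by force
    then show ?thesis
      using e finite_edges[OF G] by (auto simp: vertex_sum_def)
  qed
  have "card (verts G) * (card (verts G) + 1) \<le> 2 * \<Sum>(vertex_sum G f ` verts G)"
    using sum_of_distinct_positives_ge[of "vertex_sum G f ` verts G"] fin pos
    unfolding card_image[OF inj] by fastforce
  also have "\<Sum>(vertex_sum G f ` verts G) = 2 * \<Sum>{1..card (edges G)}"
    using sum.reindex[OF inj, of "\<lambda>x. x"] sum_vertex_sum[OF G]
      sum.reindex_bij_betw[OF f, of "\<lambda>x. x"] by simp
  also have "2 * \<Sum>{1..card (edges G)} = card (edges G) * (card (edges G) + 1)"
    by (simp add: double_gauss_sum_from_Suc_0[where 'a = nat, simplified])
  finally show ?thesis .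
qed

section \<open>Disjoint unions of a graph with paths on three vertices\<close>

lemma verts_path_3: "verts (path 3) = {0, 1, 2}"
  by (auto simp: path_def)

lemma edges_path_3: "edges (path 3) = {{0, 1}, {1, 2}}"
proof -
  have "Suc i < 3 \<longleftrightarrow> i = 0 \<or> i = 1" for i by auto
  then show ?thesis by (auto simp: path_def numeral_2_eq_2)
qed

lemma card_verts_disjoint_union:
  assumes "finite (verts G)" "finite (verts H)"
  shows "card (verts (disjoint_union G H)) = card (verts G) + card (verts H)"
  using assms by (simp add: disjoint_union_def card_Plus)

lemma inj_image: "inj h \<Longrightarrow> inj_on ((`) h) E"
  by (meson inj_image_eq_iff inj_onI)

lemma card_edges_disjoint_union:
  assumes "finite_simple G" "finite_simple H"
  shows "card (edges (disjoint_union G H)) = card (edges G) + card (edges H)"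
proof -
  have "x \<noteq> y" if "x \<in> (`) Inl ` edges G" "y \<in> (`) Inr ` edges H" for x y :: "('a + 'b) set"
  proof -
    obtain e where "e \<in> edges G" "x = Inl ` e" using \<open>x \<in> _\<close> by blast
    moreover from this have "e \<noteq> {}" using assms(1) by (auto simp: finite_simple_def)
    ultimately show ?thesis using \<open>y \<in> _\<close> by auto
  qed
  then have "(`) Inl ` edges G \<inter> (`) Inr ` edges H = {}" by blast
  then show ?thesis
    using assms[THEN finite_edges]
    by (simp add: disjoint_union_def card_Un_disjoint card_image inj_image)
qed

lemma card_verts_copies: "card (verts (copies t G)) = t * card (verts G)"
  by (simp add: copies_def card_cartesian_product)

lemma card_edges_copies:
  assumes "finite_simple G"
  shows "card (edges (copies t G)) = t * card (edges G)"
proof -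
  have "(`) (Pair i) ` edges G \<inter> (`) (Pair j) ` edges G = {}" if "i \<noteq> j" for i j :: nat
  proof -
    have "Pair i ` e \<noteq> Pair j ` e'" if "e \<in> edges G" for e e'
    proof -
      have "e \<noteq> {}" using assms \<open>e \<in> edges G\<close> by (auto simp: finite_simple_def)
      then show ?thesis using \<open>i \<noteq> j\<close> by auto
    qed
    then show ?thesis by blast
  qed
  then have "card (edges (copies t G)) = (\<Sum>i<t. card ((`) (Pair i) ` edges G))"
    using finite_edges[OF assms] by (simp add: copies_def card_UN_disjoint)
  also have "\<dots> = t * card (edges G)"
    by (simp add: card_image inj_image inj_def)
  finally show ?thesis .
qed

lemma antimagic_with_paths_bound:
  assumes G: "finite_simple G" and cover: "verts G \<subseteq> \<Union>(edges G)"
    and order: "card (verts G) = n" and size: "card (edges G) = m"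
    and anti: "antimagic (disjoint_union G (copies t (path 3)))"
  shows "(n + 3 * t) * (n + 3 * t + 1) \<le> 2 * ((m + 2 * t) * (m + 2 * t + 1))"
proof -
  let ?P = "copies t (path 3)"
  have P: "finite_simple ?P" by (intro finite_simple_copies finite_simple_path)
  have "verts ?P \<subseteq> \<Union>(edges ?P)"
    by (auto simp: copies_def verts_path_3 edges_path_3)
  then have cov: "verts (disjoint_union G ?P) \<subseteq> \<Union>(edges (disjoint_union G ?P))"
    using cover unfolding disjoint_union_def by (auto simp: image_iff) blast+
  have two: "card (edges (path 3)) = 2"
    by (simp add: edges_path_3 doubleton_eq_iff)
  have "card (verts (disjoint_union G ?P)) = n + 3 * t"
    "card (edges (disjoint_union G ?P)) = m + 2 * t"
    using G P order size two
    by (simp_all add: card_verts_disjoint_union card_edges_disjoint_union card_verts_copies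
        card_edges_copies finite_simple_path finite_simple_imp_finite verts_path_3)
  then show ?thesis
    using antimagic_order_size_bound[OF finite_simple_disjoint_union[OF G P] cov anti] by simp
qed

lemma vertex_sum_disjoint_union_Inl:
  "vertex_sum (disjoint_union G H) f (Inl v) = vertex_sum G (\<lambda>e. f (Inl ` e)) v"
proof -
  have "{e \<in> edges (disjoint_union G H). Inl v \<in> e} = (`) Inl ` {e \<in> edges G. v \<in> e}"
    by (auto simp: disjoint_union_def)
  then show ?thesis
    by (simp add: vertex_sum_def sum.reindex inj_image)
qed

lemma vertex_sum_disjoint_union_Inr:
  "vertex_sum (disjoint_union G H) f (Inr v) = vertex_sum H (\<lambda>e. f (Inr ` e)) v"
proof -
  have "{e \<in> edges (disjoint_union G H). Inr v \<in> e} = (`) Inr ` {e \<in> edges H. v \<in> e}"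
    by (auto simp: disjoint_union_def)
  then show ?thesis
    by (simp add: vertex_sum_def sum.reindex inj_image)
qed

lemma vertex_sum_copies:
  assumes "i < t"
  shows "vertex_sum (copies t G) f (i, v) = vertex_sum G (\<lambda>e. f (Pair i ` e)) v"
proof -
  have "{e \<in> edges (copies t G). (i, v) \<in> e} = (`) (Pair i) ` {e \<in> edges G. v \<in> e}"
    using assms by (auto simp: copies_def)
  then show ?thesis
    by (simp add: vertex_sum_def sum.reindex inj_image inj_def)
qed

lemma vertex_sum_path_3:
  "vertex_sum (path 3) f 0 = f {0, 1}"
  "vertex_sum (path 3) f 1 = f {0, 1} + f {1, 2}"
  "vertex_sum (path 3) f 2 = f {1, 2}"
proof -
  have "{e \<in> edges (path 3). 0 \<in> e} = {{0, 1}}" "{e \<in> edges (path 3). 2 \<in> e} = {{1, 2}}"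
    "{e \<in> edges (path 3). 1 \<in> e} = {{0, 1}, {1, 2}}"
    by (auto simp: edges_path_3)
  then show "vertex_sum (path 3) f 0 = f {0, 1}"
    "vertex_sum (path 3) f 1 = f {0, 1} + f {1, 2}"
    "vertex_sum (path 3) f 2 = f {1, 2}"
    unfolding vertex_sum_def by (simp_all add: doubleton_eq_iff)
qed

text \<open>The passage from the disjoint union with zero paths back to the graph itself, over a different
  vertex type, which the side condition in the definition of \<open>tau\<close> asks for.\<close>

lemma antimagic_disjoint_union_no_copies:
  assumes "antimagic (disjoint_union G (copies 0 H))"
  shows "antimagic G"
proof -
  let ?U = "disjoint_union G (copies 0 H)"
  obtain f where f: "antimagic_labeling ?U f" using assms by (auto simp: antimagic_def)
  have edges: "edges ?U = (`) Inl ` edges G" and verts: "verts ?U = Inl ` verts G"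
    by (auto simp: disjoint_union_def copies_def)
  have "bij_betw ((`) Inl) (edges G) (edges ?U)"
    unfolding edges by (simp add: bij_betw_def inj_image)
  then have "bij_betw (\<lambda>e. f (Inl ` e)) (edges G) {1..card (edges ?U)}"
    using f bij_betw_trans unfolding antimagic_labeling_def by (fastforce simp: comp_def)
  moreover have "card (edges ?U) = card (edges G)"
    unfolding edges by (simp add: card_image inj_image)
  ultimately have "antimagic_labeling G (\<lambda>e. f (Inl ` e))"
    using f unfolding antimagic_labeling_def verts by (auto simp: vertex_sum_disjoint_union_Inl)
  then show ?thesis by (auto simp: antimagic_def)
qed

section \<open>Cycles\<close>

abbreviation cycle_edge :: "nat \<Rightarrow> nat \<Rightarrow> nat set" where
  "cycle_edge n i \<equiv> {i, Suc i mod n}"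

lemma verts_cycle: "verts (cycle n) = {..<n}"
  by (simp add: cycle_def)

lemma edges_cycle: "edges (cycle n) = cycle_edge n ` {..<n}"
  by (auto simp: cycle_def)

lemma Suc_mod_inj_on: "inj_on (\<lambda>i. Suc i mod n) {..<n}"
  by (rule inj_onI) (auto simp: mod_Suc split: if_splits)

lemma Suc_mod_image: "(\<lambda>i. Suc i mod n) ` {..<n} = {..<n}"
  by (rule endo_inj_surj) (auto simp: Suc_mod_inj_on)

text \<open>The two failures for shorter cycles: a loop for one vertex, coinciding edges for two vertices.\<close>

lemma Suc_mod_neq:
  assumes "3 \<le> n" "i < n"
  shows "Suc i mod n \<noteq> i" "Suc (Suc i mod n) mod n \<noteq> i"
  using assms by (auto simp: mod_Suc)

lemma cycle_edge_inj_on: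
  assumes "3 \<le> n"
  shows "inj_on (cycle_edge n) {..<n}"
proof (rule inj_onI)
  fix i j assume "i \<in> {..<n}" "j \<in> {..<n}" "cycle_edge n i = cycle_edge n j"
  then show "i = j"
    using Suc_mod_neq[OF assms, of i] Suc_mod_neq[OF assms, of j] by (auto simp: doubleton_eq_iff)
qed

lemma card_edges_cycle: "3 \<le> n \<Longrightarrow> card (edges (cycle n)) = n"
  by (simp add: edges_cycle card_image cycle_edge_inj_on)

text \<open>Writing a vertex as \<open>Suc i mod n\<close> avoids the predecessor modulo \<open>n\<close> in the description of its two
  edges.\<close>

lemma edges_at_cycle_vertex:
  assumes "3 \<le> n" "i < n"
  shows "{e \<in> edges (cycle n). Suc i mod n \<in> e} = {cycle_edge n i, cycle_edge n (Suc i mod n)}"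
proof -
  have "j = i" if "Suc i mod n = Suc j mod n" "j < n" for j
    by (rule inj_onD[OF Suc_mod_inj_on that(1)[symmetric]]) (use that(2) assms(2) in auto)
  moreover have "Suc i mod n < n" using assms(1) by simp
  ultimately show ?thesis
    unfolding edges_cycle using assms(2) by blast
qed

lemma cycle_edge_Suc_neq:
  assumes "3 \<le> n" "i < n"
  shows "cycle_edge n i \<noteq> cycle_edge n (Suc i mod n)"
  using Suc_mod_neq[OF assms] by (auto simp: doubleton_eq_iff)

lemma vertex_sum_cycle:
  assumes "3 \<le> n" "i < n"
  shows "vertex_sum (cycle n) f (Suc i mod n) = f (cycle_edge n i) + f (cycle_edge n (Suc i mod n))"
proof -
  have "vertex_sum (cycle n) f (Suc i mod n) = sum f {cycle_edge n i, cycle_edge n (Suc i mod n)}"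
    unfolding vertex_sum_def by (simp only: edges_at_cycle_vertex[OF assms])
  then show ?thesis using cycle_edge_Suc_neq[OF assms] by simp
qed

lemma degree_cycle:
  assumes "3 \<le> n" "v < n"
  shows "degree (cycle n) v = 2"
proof -
  obtain i where "i < n" "v = Suc i mod n" using Suc_mod_image[of n] assms(2) by blast
  then show ?thesis
    using edges_at_cycle_vertex[of n i] cycle_edge_Suc_neq[of n i] assms(1)
    by (simp add: degree_def)
qed

lemma internal_edges_cycle: "3 \<le> n \<Longrightarrow> internal_edges (cycle n) = edges (cycle n)"
  by (auto simp: internal_edges_def leaf_def verts_cycle degree_cycle)

text \<open>An end of the path has a single neighbour, while the vertex of the component that corresponds to
  it keeps two neighbours within the component. These
  neighbours lie in it because it is closed under adjacency.\<close>

lemma component_not_path_3: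
  assumes two: "\<And>v. v \<in> verts G \<Longrightarrow>
      \<exists>x\<in>verts G. \<exists>y\<in>verts G. x \<noteq> y \<and> {v, x} \<in> edges G \<and> {v, y} \<in> edges G"
    and C: "C \<in> components G"
  shows "\<not> isomorphic C (path 3)"
proof
  assume "isomorphic C (path 3)"
  then obtain h where h: "bij_betw h (verts C) (verts (path 3))"
    and adj: "\<And>u v. u \<in> verts C \<Longrightarrow> v \<in> verts C \<Longrightarrow>
      {u, v} \<in> edges C \<longleftrightarrow> {h u, h v} \<in> edges (path 3)"
    unfolding isomorphic_def by blast
  obtain r where C_def: "C = induced G {v \<in> verts G. reachable G r v}"
    using C by (auto simp: components_def)
  obtain v where v: "v \<in> verts C" "h v = 0"
    using h unfolding bij_betw_def verts_path_3 by (metis imageE insertI1)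
  obtain x y where xy: "x \<in> verts G" "y \<in> verts G" "x \<noteq> y" "{v, x} \<in> edges G" "{v, y} \<in> edges G"
    using two[of v] v(1) by (auto simp: C_def induced_def)
  have reach: "reachable G r z" if "{v, z} \<in> edges G" for z
  proof -
    have "reachable G r v" using v(1) by (simp add: C_def induced_def)
    then show ?thesis
      using that unfolding reachable_def by (rule rtranclp.rtrancl_into_rtrancl)
  qed
  have in_C: "z \<in> verts C" "{v, z} \<in> edges C" if "z \<in> verts G" "{v, z} \<in> edges G" for z
    using v(1) that reach by (auto simp: C_def induced_def)
  have "h z = 1" if "z \<in> verts G" "{v, z} \<in> edges G" for z
    using adj[OF v(1) in_C(1)[OF that]] in_C(2)[OF that] v(2)
    by (auto simp: edges_path_3 doubleton_eq_iff)
  then have "h x = h y" using xy by simp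
  then show False
    using h xy in_C(1) by (auto simp: bij_betw_def inj_on_def)
qed

lemma cycle_component_not_path_3:
  assumes n: "3 \<le> n" and C: "C \<in> components (cycle n)"
  shows "\<not> isomorphic C (path 3)"
proof (rule component_not_path_3[OF _ C])
  fix v assume "v \<in> verts (cycle n)"
  then obtain i where i: "i < n" "v = Suc i mod n"
    using Suc_mod_image[of n] by (auto simp: verts_cycle)
  have "{v, i} \<in> edges (cycle n)" "{v, Suc v mod n} \<in> edges (cycle n)"
    using i n by (auto simp: edges_cycle insert_commute)
  moreover have "i \<noteq> Suc v mod n" using Suc_mod_neq(2)[OF n i(1)] i(2) by simp
  moreover have "i \<in> verts (cycle n)" "Suc v mod n \<in> verts (cycle n)"
    using i n by (auto simp: verts_cycle)
  ultimately show "\<exists>x\<in>verts (cycle n). \<exists>y\<in>verts (cycle n).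
      x \<noteq> y \<and> {v, x} \<in> edges (cycle n) \<and> {v, y} \<in> edges (cycle n)" by blast
qed

text \<open>With as many edges as vertices the first term of the minimum is \<open>(1 + sqrt 2) (n + 1 / 2)\<close>; the
  second one is \<open>7 n + 1\<close>, which is larger.\<close>

lemma beta_cycle:
  assumes "3 \<le> n"
  shows "beta (cycle n) = \<lfloor>(1 + sqrt 2) * (real n + 1 / 2)\<rfloor>"
proof -
  have no_P3: "{C \<in> components (cycle n). isomorphic C (path 3)} = {}"
    using cycle_component_not_path_3[OF assms] by blast
  have "sqrt 2 < 2" by (simp add: real_sqrt_less_iff[of 2 4, simplified])
  then have "(1 + sqrt 2) * (real n + 1 / 2) \<le> 3 * (real n + 1 / 2)"
    by (intro mult_right_mono) auto
  also have "\<dots> \<le> 2 * real n + 5 * real n + 1"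
    using assms by simp
  finally show ?thesis
    unfolding beta_def Let_def no_P3 using assms
    by (simp add: verts_cycle card_edges_cycle internal_edges_cycle min_def)
qed

text \<open>With \<open>d = 2 t - (2 n + 1)\<close> and \<open>c = 2 n + 1\<close> the left side says \<open>d \<le> sqrt 2 * c\<close>, that is
  \<open>d\<^sup>2 \<le> 2 c\<^sup>2\<close>; for negative \<open>d\<close> the square is harmless because \<open>- d \<le> c\<close>. Expanded, this is four
  times the quadratic inequality with an extra 1 on the right, and integrality absorbs the 1.\<close>

lemma le_floor_iff_quadratic:
  fixes n t :: nat
  shows "int t \<le> \<lfloor>(1 + sqrt 2) * (real n + 1 / 2)\<rfloor> \<longleftrightarrow> t * t \<le> (2 * n + 1) * t + n * (n + 1)"
proof -
  define d where "d = 2 * int t - (2 * int n + 1)"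
  define c where "c = 2 * int n + 1"
  have c: "0 \<le> c" by (simp add: c_def)
  have "int t \<le> \<lfloor>(1 + sqrt 2) * (real n + 1 / 2)\<rfloor> \<longleftrightarrow> real t \<le> (1 + sqrt 2) * (real n + 1 / 2)"
    by (simp add: le_floor_iff)
  also have "\<dots> \<longleftrightarrow> real_of_int d \<le> sqrt 2 * real_of_int c"
    by (simp add: d_def c_def field_simps)
  also have "sqrt 2 * real_of_int c = sqrt (2 * (real_of_int c)\<^sup>2)"
    using c by (simp add: real_sqrt_mult)
  also have "real_of_int d \<le> sqrt (2 * (real_of_int c)\<^sup>2) \<longleftrightarrow> d \<le> 0 \<or> d\<^sup>2 \<le> 2 * c\<^sup>2"
  proof (cases "d \<le> 0")
    case True
    then have "real_of_int d \<le> 0" "0 \<le> sqrt (2 * (real_of_int c)\<^sup>2)" by auto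
    then show ?thesis using True by linarith
  next
    case False
    then have "real_of_int d \<le> sqrt (2 * (real_of_int c)\<^sup>2) \<longleftrightarrow>
        real_of_int (d\<^sup>2) \<le> real_of_int (2 * c\<^sup>2)"
      by (simp add: real_le_rsqrt sqrt_ge_absD) (metis abs_of_nonneg less_imp_le linorder_not_le
          of_int_0_le_iff real_le_rsqrt sqrt_ge_absD)
    then show ?thesis using False by (simp only: of_int_le_iff) simp
  qed
  also have "\<dots> \<longleftrightarrow> d\<^sup>2 \<le> 2 * c\<^sup>2"
  proof -
    have "d\<^sup>2 \<le> c\<^sup>2" if "d \<le> 0"
      using that by (intro power2_le_iff_abs_le[THEN iffD2]) (auto simp: d_def c_def)
    then show ?thesis by (smt (verit) zero_le_power2)
  qed
  also have "\<dots> \<longleftrightarrow> 4 * (int t * int t) \<le> 4 * ((2 * int n + 1) * int t + int n * (int n + 1)) + 1"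
    by (simp add: d_def c_def power2_eq_square algebra_simps)
  \<comment> \<open>Rounding: both sides are multiples of 4 apart from the 1.\<close>
  also have "\<dots> \<longleftrightarrow> int t * int t \<le> (2 * int n + 1) * int t + int n * (int n + 1)"
    by presburger
  also have "\<dots> \<longleftrightarrow> int (t * t) \<le> int ((2 * n + 1) * t + n * (n + 1))"
    by (simp add: algebra_simps)
  finally show ?thesis by (simp only: of_nat_le_iff)
qed

lemma antimagic_cycle_paths_imp_le:
  assumes n: "3 \<le> n" and anti: "antimagic (disjoint_union (cycle n) (copies t (path 3)))"
  shows "t * t \<le> (2 * n + 1) * t + n * (n + 1)"
proof -
  have "verts (cycle n) \<subseteq> \<Union>(edges (cycle n))"
    by (auto simp: verts_cycle edges_cycle)
  then have "(n + 3 * t) * (n + 3 * t + 1) \<le> 2 * ((n + 2 * t) * (n + 2 * t + 1))"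
    using antimagic_with_paths_bound[OF finite_simple_cycle[OF n] _ _ _ anti] n
    by (simp add: verts_cycle card_edges_cycle)
  then show ?thesis by (simp add: algebra_simps)
qed

section \<open>Labelings given by lists\<close>

text \<open>The list \<open>cs\<close> holds the labels around a cycle, and \<open>ps\<close> one pair of labels for each path on three
  vertices. The entries of \<open>vertex_sums\<close> belong in turn to the cycle vertices, the two groups of path
  ends, and the path centres. Distinct labels from \<open>{1..m}\<close>, as many as \<open>m\<close>, exhaust \<open>{1..m}\<close>,
  so the conditions on labels amount to a bijection.\<close>

definition labeling_certificate :: "nat list \<Rightarrow> (nat \<times> nat) list \<Rightarrow> bool" where
  "labeling_certificate cs ps \<longleftrightarrow>
     (let labels = cs @ map fst ps @ map snd ps;
          vertex_sums = map2 (+) cs (rotate1 cs) @ map fst ps @ map snd ps @ map (\<lambda>(a, b). a + b) ps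
      in distinct labels \<and> list_all (\<lambda>x. 1 \<le> x \<and> x \<le> length labels) labels \<and> distinct vertex_sums)"

lemma ex_fun_map_eq:
  assumes "distinct xs" "length xs = length ys"
  obtains f where "map f xs = ys"
proof
  show "map (the \<circ> map_of (zip xs ys)) xs = ys"
    using assms by (intro nth_equalityI) (auto simp: map_of_zip_nth)
qed

text \<open>Enumerations of edges and vertices turn both conditions on a labeling into distinctness of lists.\<close>

lemma antimagic_labeling_listI:
  assumes edges: "distinct es" "set es = edges G" and verts: "set vs = verts G"
    and labels: "distinct (map f es)" "\<And>e. e \<in> set es \<Longrightarrow> 1 \<le> f e \<and> f e \<le> length es"
    and sums: "distinct (map (vertex_sum G f) vs)"
  shows "antimagic_labeling G f"
proof -
  have inj: "inj_on f (edges G)" using labels(1) edges(2) by (simp add: distinct_map)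
  have card: "card (edges G) = length es" using edges distinct_card by metis
  have "f ` edges G = {1..card (edges G)}"
  proof (rule card_subset_eq)
    show "f ` edges G \<subseteq> {1..card (edges G)}"
      using labels(2) card edges(2) by auto
  qed (auto simp: card_image[OF inj])
  moreover have "inj_on (vertex_sum G f) (verts G)"
    using sums verts by (simp add: distinct_map)
  ultimately show ?thesis
    using inj by (auto simp: antimagic_labeling_def bij_betw_def inj_on_def)
qed

text \<open>Edges and vertices of the union are enumerated in the order in which the certificate lists labels
  and vertex sums, so that mapping the labeling over the edges gives the labels and mapping
  \<open>vertex_sum\<close> over the vertices gives the vertex sums.\<close>

lemma antimagic_if_labeling_certificate:
  assumes n: "3 \<le> length cs" and cert: "labeling_certificate cs ps"
  shows "antimagic (disjoint_union (cycle (length cs)) (copies (length ps) (path 3)))"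
proof -
  define n where "n = length cs"
  define t where "t = length ps"
  let ?G = "disjoint_union (cycle n) (copies t (path 3))"
  have n: "3 \<le> n" using assms by (simp add: n_def)
  define c :: "nat \<Rightarrow> (nat + nat \<times> nat) set" where "c = (\<lambda>i. Inl ` cycle_edge n i)"
  define p q :: "nat \<Rightarrow> (nat + nat \<times> nat) set"
    where "p = (\<lambda>i. Inr ` Pair i ` {0, 1})" and "q = (\<lambda>i. Inr ` Pair i ` {1, 2})"
  define es where "es = map c [0..<n] @ map p [0..<t] @ map q [0..<t]"
  \<comment> \<open>The shift of the cycle vertices makes entry \<open>i\<close> the common end of the cycle edges \<open>i\<close> and
    \<open>Suc i mod n\<close>, as in \<open>rotate1\<close>.\<close>
  define vs :: "(nat + nat \<times> nat) list" where
    "vs = map (\<lambda>i. Inl (Suc i mod n)) [0..<n] @ map (\<lambda>i. Inr (i, 0)) [0..<t]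
       @ map (\<lambda>i. Inr (i, 2)) [0..<t] @ map (\<lambda>i. Inr (i, 1)) [0..<t]"
  have c_inj: "inj_on c {..<n}"
    using comp_inj_on[OF cycle_edge_inj_on[OF n] inj_image[of Inl]] by (simp add: c_def comp_def)
  have pq: "inj_on p A" "inj_on q A" "p i \<noteq> q j" "c i \<noteq> p j" "c i \<noteq> q j" for A i j
  proof -
    \<comment> \<open>Each edge is recognised by a vertex that it contains.\<close>
    have mem: "Inr (i, 0) \<in> p j \<longleftrightarrow> i = j" "Inr (i, 2) \<in> q j \<longleftrightarrow> i = j" "Inr (i, 0) \<notin> q j"
      "Inl i \<in> c i" "Inl i \<notin> p j" "Inl i \<notin> q j" for i j
      by (auto simp: c_def p_def q_def)
    then show "inj_on p A" "inj_on q A" by (metis inj_onI)+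
    show "p i \<noteq> q j" "c i \<noteq> p j" "c i \<noteq> q j" using mem by metis+
  qed
  have es: "distinct es"
    unfolding es_def distinct_append distinct_map
    using c_inj pq(1,2) pq(3-5)[THEN not_sym] pq(3-5) by (auto simp: atLeast0LessThan)
  have set_es: "set es = edges ?G"
  proof -
    have "(\<Union>i<t. (`) (Pair i) ` edges (path 3)) = (\<Union>i<t. {Pair i ` {0, 1}, Pair i ` {1, 2}})"
      by (simp add: edges_path_3)
    then have "edges ?G = c ` {..<n} \<union> (\<Union>i<t. {p i, q i})"
      by (simp add: disjoint_union_def copies_def edges_cycle image_image image_UN c_def p_def q_def)
    also have "\<dots> = set es" by (auto simp: es_def)
    finally show ?thesis by simp
  qed
  have set_vs: "set vs = verts ?G"
  proof -
    have "set vs = Inl ` (\<lambda>i. Suc i mod n) ` {..<n} \<union> Inr ` ({..<t} \<times> verts (path 3))"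
      unfolding vs_def verts_path_3 by (auto simp: image_image atLeast0LessThan)
    then show ?thesis
      unfolding Suc_mod_image by (simp add: disjoint_union_def copies_def verts_cycle Plus_def)
  qed
  let ?labels = "cs @ map fst ps @ map snd ps"
  have len: "length es = length ?labels" by (simp add: es_def n_def t_def)
  obtain f where f: "map f es = ?labels"
    using ex_fun_map_eq[OF es len] by blast
  then have "map f (map c [0..<n]) = cs \<and> map f (map p [0..<t]) = map fst ps
      \<and> map f (map q [0..<t]) = map snd ps"
    by (simp add: es_def n_def t_def append_eq_append_conv)
  then have "\<And>i. i < n \<Longrightarrow> map f (map c [0..<n]) ! i = cs ! i"
    "\<And>i. i < t \<Longrightarrow> map f (map p [0..<t]) ! i = map fst ps ! i"
    "\<And>i. i < t \<Longrightarrow> map f (map q [0..<t]) ! i = map snd ps ! i"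
    by auto
  then have f_nth: "\<And>i. i < n \<Longrightarrow> f (c i) = cs ! i"
    "\<And>i. i < t \<Longrightarrow> f (p i) = fst (ps ! i)" "\<And>i. i < t \<Longrightarrow> f (q i) = snd (ps ! i)"
    by (simp_all add: t_def)
  have cycle_sum: "vertex_sum ?G f (Inl (Suc i mod n)) = cs ! i + cs ! (Suc i mod n)" if "i < n" for i
    using vertex_sum_cycle[OF n that, of "\<lambda>e. f (Inl ` e)"] f_nth(1)[of i]
      f_nth(1)[of "Suc i mod n"] that
    unfolding vertex_sum_disjoint_union_Inl c_def by simp
  have path_sum: "vertex_sum ?G f (Inr (i, 0)) = fst (ps ! i)"
    "vertex_sum ?G f (Inr (i, 2)) = snd (ps ! i)"
    "vertex_sum ?G f (Inr (i, 1)) = fst (ps ! i) + snd (ps ! i)" if "i < t" for i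
    using f_nth(2,3)[OF that]
    unfolding vertex_sum_disjoint_union_Inr vertex_sum_copies[OF that] vertex_sum_path_3 p_def q_def
    by simp_all
  have "map (vertex_sum ?G f) (map (\<lambda>i. Inl (Suc i mod n)) [0..<n]) = map2 (+) cs (rotate1 cs)"
    by (intro nth_equalityI) (auto simp: n_def[symmetric] cycle_sum nth_rotate1)
  moreover have
    "map (vertex_sum ?G f) (map (\<lambda>i. Inr (i, 0)) [0..<t]) = map fst ps"
    "map (vertex_sum ?G f) (map (\<lambda>i. Inr (i, 2)) [0..<t]) = map snd ps"
    "map (vertex_sum ?G f) (map (\<lambda>i. Inr (i, 1)) [0..<t]) = map (\<lambda>(a, b). a + b) ps"
    by (intro nth_equalityI; simp add: t_def[symmetric] path_sum[simplified] path_sum split_beta)+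
  ultimately have sums: "map (vertex_sum ?G f) vs =
      map2 (+) cs (rotate1 cs) @ map fst ps @ map snd ps @ map (\<lambda>(a, b). a + b) ps"
    unfolding vs_def map_append by simp
  have "antimagic_labeling ?G f"
  proof (rule antimagic_labeling_listI[OF es set_es set_vs])
    show "distinct (map f es)" "distinct (map (vertex_sum ?G f) vs)"
      using cert unfolding f sums labeling_certificate_def Let_def by blast+
    have "\<forall>x\<in>set (map f es). 1 \<le> x \<and> x \<le> length es"
      using cert unfolding f len labeling_certificate_def Let_def list_all_iff by blast
    then show "1 \<le> f e \<and> f e \<le> length es" if "e \<in> set es" for e
      using that by simp
  qed
  then show ?thesis unfolding antimagic_def n_def t_def by blast
qed

text \<open>Entry \<open>t\<close> of a table is a certificate for \<open>t\<close> paths.\<close>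

definition labeling_table :: "nat \<Rightarrow> (nat list \<times> (nat \<times> nat) list) list \<Rightarrow> bool" where
  "labeling_table n table \<longleftrightarrow>
     map (\<lambda>(cs, ps). length ps) table = [0..<length table] \<and>
     list_all (\<lambda>(cs, ps). length cs = n \<and> labeling_certificate cs ps) table"

lemma antimagic_if_labeling_table:
  assumes "3 \<le> n" and table: "labeling_table n table" and t: "t < length table"
  shows "antimagic (disjoint_union (cycle n) (copies t (path 3)))"
proof -
  obtain cs ps where entry: "table ! t = (cs, ps)" by force
  have "map (\<lambda>(cs, ps). length ps) table ! t = [0..<length table] ! t"
    using table by (simp add: labeling_table_def)
  then have "length ps = t" using t entry by simp
  moreover have "length cs = n" "labeling_certificate cs ps"
    using table t entry by (auto simp: labeling_table_def list_all_length)
  ultimately show ?thesis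
    using antimagic_if_labeling_certificate[of cs ps] assms(1) by simp
qed

section \<open>Labelings of the cycles with three to nine vertices\<close>

text \<open>
  The labelings come from a randomised search: draw the cycle labels at random, subject to the sums at
  the cycle vertices being distinct and avoiding the path labels, and pair up the remaining labels by
  backtracking, always branching on a label with few admissible partners. A centre sum that is at most
  \<open>m\<close> must be a cycle label, as all other labels up to \<open>m\<close> are sums at path ends. For the largest \<open>t\<close>
  there is little freedom: for \<open>n = 7\<close> and \<open>t = 18\<close> the 61 sums have to be \<open>1, \<dots>, 60\<close> and \<open>62\<close>.
\<close>

lemma antimagic_cycle_3_with_paths:
  assumes "t \<le> 8"
  shows "antimagic (disjoint_union (cycle 3) (copies t (path 3)))"
proof (rule antimagic_if_labeling_table)
  show "labeling_table 3
    [([2, 1, 3], []),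
      ([4, 5, 3], [(1, 2)]),
      ([5, 7, 4], [(1, 3), (2, 6)]),
      ([8, 3, 9], [(1, 2), (7, 6), (4, 5)]),
      ([7, 9, 8], [(1, 6), (2, 10), (11, 3), (4, 5)]),
      ([10, 7, 11], [(1, 6), (2, 13), (3, 8), (4, 12), (5, 9)]),
      ([9, 13, 4], [(1, 3), (2, 7), (5, 11), (6, 14), (12, 15), (8, 10)]),
      ([12, 8, 16], [(1, 7), (2, 10), (3, 15), (4, 17), (5, 11), (6, 13), (9, 14)]),
      ([13, 14, 9], [(1, 8), (2, 11), (3, 17), (4, 10), (5, 19), (6, 15), (7, 18), (12, 16)])]"
    by code_simp
qed (use assms in simp_all)

lemma antimagic_cycle_4_with_paths:
  assumes "t \<le> 10"
  shows "antimagic (disjoint_union (cycle 4) (copies t (path 3)))"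
proof (rule antimagic_if_labeling_table)
  show "labeling_table 4
    [([3, 1, 2, 4], []),
      ([4, 2, 6, 5], [(1, 3)]),
      ([4, 7, 2, 8], [(6, 1), (3, 5)]),
      ([3, 4, 7, 9], [(1, 2), (6, 8), (5, 10)]),
      ([3, 11, 10, 12], [(1, 2), (9, 8), (4, 6), (5, 7)]),
      ([10, 14, 11, 9], [(1, 8), (2, 13), (3, 7), (4, 12), (5, 6)]),
      ([14, 13, 7, 10], [(1, 6), (2, 8), (5, 16), (3, 15), (4, 9), (11, 12)]),
      ([16, 6, 14, 17], [(2, 4), (1, 13), (3, 18), (5, 11), (7, 12), (10, 15), (8, 9)]),
      ([15, 9, 18, 8], [(1, 7), (2, 13), (3, 6), (4, 14), (5, 16), (10, 12), (11, 17), (19,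
       20)]),
      ([9, 15, 13, 16], [(1, 8), (2, 11), (3, 12), (4, 19), (5, 21), (6, 10), (7, 20), (14, 17),
       (18, 22)]),
      ([16, 14, 13, 19], [(1, 12), (2, 17), (3, 11), (4, 21), (5, 24), (6, 20), (7, 9), (8, 23),
       (10, 18), (15, 22)])]"
    by code_simp
qed (use assms in simp_all)

lemma antimagic_cycle_5_with_paths:
  assumes "t \<le> 13"
  shows "antimagic (disjoint_union (cycle 5) (copies t (path 3)))"
proof (rule antimagic_if_labeling_table)
  show "labeling_table 5
    [([3, 1, 4, 2, 5], []),
      ([7, 5, 2, 4, 6], [(1, 3)]),
      ([6, 4, 5, 8, 9], [(7, 1), (2, 3)]),
      ([9, 8, 7, 1, 11], [(2, 5), (3, 6), (4, 10)]),
      ([12, 6, 9, 10, 11], [(1, 5), (2, 7), (3, 8), (4, 13)]),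
      ([14, 13, 10, 6, 15], [(1, 5), (2, 8), (3, 12), (4, 9), (7, 11)]),
      ([11, 14, 5, 17, 13], [(1, 4), (9, 2), (3, 10), (6, 8), (7, 16), (12, 15)]),
      ([14, 13, 17, 19, 5], [(1, 4), (2, 12), (3, 10), (6, 11), (7, 15), (8, 18), (9, 16)]),
      ([7, 17, 18, 19, 11], [(1, 6), (2, 9), (3, 14), (4, 15), (5, 21), (8, 20), (16, 13), (10,
       12)]),
      ([15, 11, 18, 21, 10], [(1, 9), (2, 13), (3, 8), (4, 14), (7, 17), (5, 16), (6, 22), (12,
       20), (19, 23)]),
      ([12, 24, 9, 23, 14], [(1, 8), (2, 10), (3, 11), (4, 20), (5, 18), (6, 21), (7, 22), (13,
       15), (16, 19), (17, 25)]),
      ([26, 21, 14, 17, 4], [(1, 3), (2, 12), (5, 23), (6, 11), (7, 19), (8, 24), (9, 25), (10,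
       27), (13, 16), (15, 18), (20, 22)]),
      ([19, 28, 10, 22, 9], [(1, 8), (2, 17), (3, 7), (4, 18), (5, 25), (6, 29), (11, 23), (12,
       21), (13, 24), (14, 26), (15, 27), (16, 20)]),
      ([18, 28, 13, 29, 10], [(1, 9), (2, 11), (3, 15), (4, 25), (5, 27), (6, 30), (7, 31), (8,
       26), (12, 23), (14, 19), (16, 24), (17, 20), (21, 22)])]"
    by code_simp
qed (use assms in simp_all)

lemma antimagic_cycle_6_with_paths:
  assumes "t \<le> 15"
  shows "antimagic (disjoint_union (cycle 6) (copies t (path 3)))"
proof (rule antimagic_if_labeling_table)
  show "labeling_table 6
    [([1, 4, 2, 5, 6, 3], []),
      ([5, 4, 8, 6, 7, 1], [(2, 3)]),
      ([2, 6, 5, 9, 8, 7], [(1, 4), (3, 10)]),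
      ([10, 6, 8, 1, 9, 11], [(2, 4), (3, 5), (7, 12)]),
      ([13, 12, 7, 5, 10, 3], [(11, 6), (1, 4), (2, 8), (9, 14)]),
      ([12, 13, 3, 16, 10, 11], [(1, 2), (15, 5), (14, 4), (6, 7), (8, 9)]),
      ([11, 4, 15, 18, 14, 10], [(1, 3), (2, 8), (7, 13), (5, 6), (9, 16), (12, 17)]),
      ([2, 20, 18, 9, 10, 19], [(1, 8), (5, 15), (3, 7), (4, 14), (6, 17), (11, 13), (12, 16)]),
      ([7, 13, 17, 9, 22, 20], [(1, 6), (2, 11), (3, 14), (4, 5), (8, 15), (10, 12), (16, 19),
       (18, 21)]),
      ([22, 9, 10, 24, 8, 19], [(1, 7), (2, 20), (3, 6), (4, 21), (5, 23), (11, 13), (16, 14),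
       (12, 17), (15, 18)]),
      ([17, 26, 13, 14, 15, 20], [(1, 12), (2, 18), (3, 11), (4, 22), (5, 10), (6, 25), (7, 21),
       (8, 9), (16, 24), (19, 23)]),
      ([19, 23, 27, 18, 13, 10], [(1, 9), (2, 11), (3, 15), (4, 26), (5, 14), (6, 21), (7, 25),
       (8, 28), (12, 22), (16, 17), (20, 24)]),
      ([23, 24, 16, 22, 14, 27], [(1, 13), (2, 21), (3, 19), (4, 12), (5, 28), (6, 18), (7, 25),
       (8, 26), (9, 30), (10, 17), (11, 20), (15, 29)]),
      ([24, 16, 31, 32, 10, 14], [(1, 9), (2, 12), (3, 13), (4, 27), (5, 29), (6, 26), (7, 28),
       (8, 25), (11, 30), (15, 21), (17, 22), (18, 19), (20, 23)]),
      ([11, 32, 13, 25, 19, 21], [(1, 10), (2, 17), (3, 18), (4, 9), (5, 20), (6, 29), (7, 30),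
       (8, 28), (12, 27), (14, 34), (15, 26), (16, 33), (22, 24), (23, 31)]),
      ([36, 8, 35, 11, 24, 13], [(1, 7), (2, 9), (3, 10), (4, 20), (5, 31), (6, 32), (12, 27),
       (14, 26), (15, 30), (16, 25), (17, 34), (18, 29), (19, 23), (21, 33), (22, 28)])]"
    by code_simp
qed (use assms in simp_all)

lemma antimagic_cycle_7_with_paths:
  assumes "t \<le> 18"
  shows "antimagic (disjoint_union (cycle 7) (copies t (path 3)))"
proof (rule antimagic_if_labeling_table)
  show "labeling_table 7
    [([7, 5, 6, 4, 3, 2, 1], []),
      ([1, 2, 4, 7, 3, 9, 6], [(5, 8)]),
      ([5, 8, 11, 6, 4, 2, 10], [(9, 7), (1, 3)]),
      ([12, 11, 13, 1, 9, 7, 10], [(2, 5), (3, 6), (4, 8)]),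
      ([12, 15, 8, 13, 6, 11, 4], [(14, 10), (9, 2), (7, 5), (1, 3)]),
      ([5, 17, 16, 15, 12, 9, 10], [(1, 4), (2, 8), (3, 6), (14, 11), (7, 13)]),
      ([9, 12, 5, 19, 10, 17, 13], [(14, 6), (3, 2), (1, 11), (4, 15), (7, 16), (8, 18)]),
      ([9, 14, 4, 21, 15, 18, 12], [(1, 3), (2, 7), (5, 10), (6, 8), (20, 17), (11, 13), (16,
       19)]),
      ([16, 10, 18, 7, 17, 23, 19], [(1, 6), (2, 8), (3, 13), (4, 15), (5, 12), (9, 14), (22,
       11), (20, 21)]),
      ([25, 23, 12, 13, 8, 21, 11], [(1, 7), (2, 9), (3, 10), (4, 19), (5, 22), (6, 20), (14,
       16), (17, 24), (15, 18)]),
      ([14, 27, 15, 23, 10, 19, 13], [(1, 9), (2, 12), (3, 16), (4, 11), (7, 6), (5, 18), (8,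
       20), (17, 22), (21, 25), (24, 26)]),
      ([22, 11, 23, 16, 20, 29, 8], [(1, 7), (2, 9), (3, 13), (4, 18), (5, 15), (6, 17), (10,
       19), (12, 26), (14, 21), (24, 27), (25, 28)]),
      ([8, 18, 26, 13, 28, 31, 5], [(1, 4), (2, 6), (3, 15), (7, 21), (9, 23), (10, 25), (11,
       20), (12, 22), (14, 19), (16, 24), (17, 30), (27, 29)]),
      ([27, 22, 16, 21, 20, 33, 24], [(1, 15), (2, 18), (3, 19), (4, 23), (6, 29), (5, 28), (7,
       14), (8, 31), (9, 25), (10, 26), (17, 30), (11, 13), (12, 32)]),
      ([34, 6, 32, 19, 7, 27, 26], [(1, 5), (2, 17), (3, 4), (8, 24), (9, 18), (10, 29), (11,
       25), (12, 30), (13, 28), (14, 23), (15, 31), (16, 33), (20, 35), (21, 22)]),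
      ([26, 28, 33, 15, 31, 22, 19], [(1, 14), (2, 17), (3, 23), (11, 20), (4, 18), (5, 34), (6,
       27), (7, 21), (8, 35), (9, 29), (10, 30), (12, 32), (13, 37), (16, 36), (24, 25)]),
      ([27, 32, 12, 35, 26, 28, 18], [(1, 11), (2, 16), (3, 23), (4, 24), (5, 22), (8, 33), (6,
       29), (7, 36), (9, 31), (10, 38), (13, 19), (14, 37), (15, 34), (17, 25), (20, 30), (21,
       39)]),
      ([35, 12, 36, 19, 41, 16, 26], [(1, 11), (2, 14), (3, 23), (4, 15), (5, 30), (6, 38), (7,
       29), (8, 33), (10, 39), (9, 34), (13, 37), (17, 28), (18, 40), (20, 31), (21, 32), (22,
       24), (25, 27)]),
      ([30, 27, 35, 12, 43, 6, 29], [(1, 5), (2, 10), (3, 24), (4, 25), (7, 23), (8, 36), (9,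
       34), (11, 37), (13, 33), (14, 38), (15, 39), (16, 40), (17, 41), (18, 42), (19, 26), (20,
       31), (21, 32), (22, 28)])]"
    by code_simp
qed (use assms in simp_all)

lemma antimagic_cycle_8_with_paths:
  assumes "t \<le> 20"
  shows "antimagic (disjoint_union (cycle 8) (copies t (path 3)))"
proof (rule antimagic_if_labeling_table)
  show "labeling_table 8
    [([1, 4, 7, 5, 3, 6, 8, 2], []),
      ([10, 8, 2, 5, 3, 6, 9, 7], [(1, 4)]),
      ([8, 3, 1, 9, 4, 12, 10, 11], [(5, 7), (2, 6)]),
      ([9, 13, 3, 5, 12, 8, 10, 14], [(1, 2), (11, 4), (6, 7)]),
      ([7, 12, 9, 3, 10, 13, 14, 15], [(1, 2), (16, 8), (11, 6), (4, 5)]),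
      ([7, 12, 5, 17, 10, 2, 16, 18], [(1, 9), (3, 4), (6, 14), (8, 13), (11, 15)]),
      ([7, 14, 17, 16, 10, 19, 15, 8], [(1, 6), (2, 20), (18, 9), (3, 5), (11, 13), (4, 12)]),
      ([18, 22, 9, 21, 20, 6, 17, 19], [(1, 5), (2, 7), (3, 15), (4, 13), (16, 8), (14, 11),
       (10, 12)]),
      ([18, 21, 19, 16, 10, 24, 12, 20], [(1, 9), (2, 14), (3, 15), (4, 8), (5, 23), (6, 13),
       (7, 17), (11, 22)]),
      ([6, 26, 18, 24, 21, 12, 14, 23], [(1, 5), (2, 10), (3, 11), (4, 17), (7, 16), (8, 19),
       (9, 22), (20, 15), (13, 25)]),
      ([14, 28, 20, 19, 6, 25, 13, 27], [(1, 5), (2, 11), (3, 16), (4, 10), (7, 21), (8, 12),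
       (9, 18), (15, 17), (22, 23), (24, 26)]),
      ([12, 10, 20, 30, 24, 13, 26, 22], [(1, 9), (2, 11), (3, 17), (4, 8), (5, 21), (7, 25),
       (6, 18), (14, 19), (27, 15), (16, 29), (23, 28)]),
      ([32, 15, 26, 17, 19, 25, 23, 27], [(1, 14), (2, 21), (3, 16), (4, 13), (5, 20), (6, 28),
       (7, 31), (8, 18), (9, 24), (11, 29), (10, 22), (12, 30)]),
      ([28, 27, 18, 24, 3, 16, 19, 31], [(1, 2), (4, 12), (5, 13), (6, 22), (7, 17), (8, 23),
       (9, 29), (10, 26), (11, 30), (14, 25), (15, 34), (20, 32), (21, 33)]),
      ([12, 19, 35, 16, 36, 34, 10, 31], [(1, 9), (2, 14), (3, 32), (4, 8), (5, 29), (6, 13),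
       (7, 30), (11, 25), (15, 23), (17, 22), (18, 24), (21, 26), (20, 28), (27, 33)]),
      ([35, 16, 27, 26, 14, 38, 20, 22], [(1, 13), (2, 18), (3, 19), (4, 12), (5, 21), (6, 29),
       (7, 32), (8, 30), (9, 37), (10, 17), (11, 34), (15, 33), (23, 24), (25, 31), (28, 36)]),
      ([10, 39, 21, 30, 40, 23, 19, 38], [(1, 9), (2, 17), (3, 18), (4, 26), (5, 33), (6, 35),
       (7, 16), (8, 31), (11, 29), (12, 32), (13, 34), (14, 36), (15, 28), (20, 25), (22, 24),
       (27, 37)]),
      ([14, 35, 17, 33, 25, 20, 23, 39], [(1, 13), (2, 15), (3, 22), (4, 16), (5, 18), (6, 27),
       (7, 28), (8, 31), (9, 37), (10, 34), (11, 36), (12, 42), (19, 29), (21, 30), (24, 32),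
       (26, 38), (40, 41)]),
      ([40, 17, 43, 12, 36, 5, 41, 27], [(1, 4), (2, 10), (3, 14), (6, 21), (7, 29), (8, 32),
       (9, 34), (11, 38), (13, 37), (15, 30), (16, 31), (18, 35), (22, 39), (19, 44), (20, 42),
       (23, 33), (24, 28), (25, 26)]),
      ([15, 18, 38, 33, 27, 23, 25, 34], [(1, 14), (2, 16), (3, 20), (4, 21), (5, 22), (6, 28),
       (7, 31), (8, 39), (9, 42), (10, 44), (11, 41), (12, 43), (13, 40), (17, 45), (19, 46),
       (24, 37), (26, 32), (29, 35), (30, 36)]),
      ([15, 36, 24, 32, 18, 22, 40, 21], [(1, 14), (2, 16), (3, 19), (4, 17), (5, 27), (6, 43),
       (7, 45), (8, 46), (9, 44), (10, 48), (11, 13), (12, 47), (20, 35), (23, 34), (25, 39),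
       (26, 41), (29, 37), (28, 42), (30, 33), (31, 38)])]"
    by code_simp
qed (use assms in simp_all)

lemma antimagic_cycle_9_with_paths:
  assumes "t \<le> 22"
  shows "antimagic (disjoint_union (cycle 9) (copies t (path 3)))"
proof (rule antimagic_if_labeling_table)
  show "labeling_table 9
    [([5, 8, 9, 6, 2, 1, 3, 4, 7], []),
      ([8, 4, 5, 3, 7, 9, 10, 11, 6], [(1, 2)]),
      ([11, 5, 3, 1, 2, 4, 7, 8, 6], [(9, 10), (12, 13)]),
      ([13, 14, 8, 10, 15, 1, 9, 6, 11], [(12, 2), (3, 5), (4, 7)]),
      ([2, 7, 13, 14, 15, 17, 6, 9, 5], [(1, 4), (3, 10), (11, 8), (12, 16)]),
      ([18, 7, 3, 13, 15, 16, 17, 10, 12], [(19, 1), (2, 5), (14, 9), (8, 4), (6, 11)]),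
      ([8, 18, 15, 20, 7, 1, 19, 9, 21], [(2, 5), (3, 12), (4, 17), (16, 6), (10, 13), (11,
       14)]),
      ([20, 6, 18, 17, 2, 21, 8, 19, 23], [(1, 5), (3, 14), (4, 16), (7, 11), (9, 12), (10, 22),
       (13, 15)]),
      ([23, 16, 11, 12, 19, 24, 17, 13, 6], [(1, 5), (2, 9), (3, 10), (4, 8), (7, 21), (14, 18),
       (15, 20), (22, 25)]),
      ([10, 24, 7, 12, 4, 20, 16, 25, 19], [(1, 3), (2, 5), (6, 14), (8, 17), (9, 21), (11, 22),
       (13, 15), (18, 27), (23, 26)]),
      ([20, 24, 26, 23, 19, 18, 22, 10, 14], [(1, 9), (2, 12), (3, 15), (4, 16), (5, 17), (6,
       13), (7, 29), (8, 25), (11, 28), (21, 27)]),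
      ([14, 20, 28, 5, 23, 22, 18, 26, 29], [(1, 4), (2, 12), (3, 15), (6, 17), (7, 13), (8,
       21), (9, 27), (10, 16), (11, 24), (19, 30), (25, 31)]),
      ([14, 13, 18, 31, 28, 16, 27, 10, 24], [(1, 9), (2, 11), (3, 15), (4, 12), (5, 19), (8,
       6), (7, 21), (17, 22), (20, 25), (23, 29), (26, 30), (32, 33)]),
      ([19, 14, 24, 29, 27, 33, 35, 13, 31], [(1, 12), (2, 17), (3, 11), (4, 20), (5, 22), (6,
       23), (7, 30), (8, 28), (9, 26), (10, 21), (18, 34), (16, 25), (15, 32)]),
      ([21, 37, 9, 25, 31, 6, 34, 26, 24], [(1, 5), (2, 7), (3, 18), (4, 20), (8, 17), (10, 16),
       (11, 27), (12, 19), (13, 30), (14, 28), (15, 29), (22, 32), (23, 36), (33, 35)]),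
      ([18, 12, 30, 15, 19, 25, 34, 32, 37], [(1, 11), (2, 13), (3, 16), (4, 14), (5, 20), (6,
       26), (7, 33), (8, 29), (9, 39), (10, 31), (17, 35), (21, 22), (23, 24), (27, 38), (28,
       36)]),
      ([36, 12, 16, 34, 31, 28, 19, 24, 32], [(1, 11), (8, 23), (2, 14), (3, 21), (4, 15), (5,
       27), (6, 30), (7, 35), (9, 25), (10, 39), (13, 33), (17, 38), (18, 26), (20, 37), (22,
       29), (40, 41)]),
      ([42, 33, 22, 26, 16, 43, 29, 17, 5], [(1, 4), (2, 14), (3, 23), (6, 11), (7, 36), (8,
       21), (9, 24), (10, 34), (12, 37), (13, 32), (15, 35), (18, 39), (19, 41), (20, 31), (25,
       27), (28, 30), (38, 40)]),
      ([38, 40, 23, 18, 5, 31, 41, 36, 24], [(1, 4), (2, 16), (3, 21), (6, 25), (7, 33), (8,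
       30), (9, 37), (10, 39), (11, 43), (12, 35), (13, 45), (14, 42), (15, 44), (17, 34), (19,
       29), (20, 32), (22, 28), (26, 27)]),
      ([25, 22, 27, 26, 41, 28, 43, 5, 47], [(1, 4), (2, 20), (3, 23), (6, 19), (7, 21), (8,
       33), (9, 18), (10, 40), (11, 32), (12, 39), (13, 42), (14, 44), (15, 45), (16, 38), (17,
       46), (24, 35), (29, 36), (37, 31), (30, 34)]),
      ([16, 45, 29, 47, 28, 25, 34, 36, 9], [(1, 8), (2, 14), (3, 26), (4, 24), (5, 31), (6,
       41), (7, 27), (10, 40), (11, 43), (12, 39), (13, 42), (15, 37), (17, 46), (18, 48), (19,
       49), (20, 38), (21, 44), (22, 35), (23, 33), (30, 32)]),
      ([31, 32, 29, 41, 26, 46, 33, 36, 37], [(1, 25), (2, 27), (3, 28), (4, 42), (5, 47), (6,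
       30), (7, 34), (8, 24), (9, 44), (10, 23), (11, 43), (12, 48), (13, 45), (14, 50), (15,
       22), (16, 49), (17, 38), (18, 39), (19, 40), (20, 51), (21, 35)]),
      ([31, 34, 37, 27, 47, 21, 35, 46, 30], [(1, 20), (2, 25), (3, 28), (4, 26), (5, 29), (6,
       40), (7, 48), (8, 39), (9, 45), (10, 49), (11, 24), (12, 50), (13, 44), (14, 53), (15,
       51), (16, 42), (17, 43), (18, 19), (22, 41), (23, 52), (32, 38), (33, 36)])]"
    by code_simp
qed (use assms in simp_all)

text \<open>The inequality for \<open>t\<close> caps \<open>t\<close> at the last index of the table for \<open>n\<close>.\<close>

lemma antimagic_small_cycle_with_paths:
  assumes "3 \<le> n" "n \<le> 9" and t: "t * t \<le> (2 * n + 1) * t + n * (n + 1)"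
  shows "antimagic (disjoint_union (cycle n) (copies t (path 3)))"
proof -
  \<comment> \<open>The left side of \<open>t * (t - (2 * n + 1)) \<le> n * (n + 1)\<close> grows with \<open>t\<close>, so it suffices that the
    inequality fails at \<open>k + 1\<close>.\<close>
  have root: "t \<le> k" if "n * (n + 1) < (k - 2 * n) * (k + 1)" "2 * n \<le> k" for k
  proof (rule ccontr)
    assume "\<not> t \<le> k"
    then have k: "k + 1 \<le> t" by simp
    have "(k - 2 * n) * (k + 1) \<le> (t - (2 * n + 1)) * t"
      using k by (intro mult_le_mono) auto
    also have "\<dots> \<le> n * (n + 1)" using t by (simp add: diff_mult_distrib)
    finally show False using that(1) by simp
  qed
  consider "n = 3" | "n = 4" | "n = 5" | "n = 6" | "n = 7" | "n = 8" | "n = 9"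
    using assms(1,2) by linarith
  then show ?thesis
  proof cases
    case 1
    then show ?thesis using root[of 8] antimagic_cycle_3_with_paths by simp
  next
    case 2
    then show ?thesis using root[of 10] antimagic_cycle_4_with_paths by simp
  next
    case 3
    then show ?thesis using root[of 13] antimagic_cycle_5_with_paths by simp
  next
    case 4
    then show ?thesis using root[of 15] antimagic_cycle_6_with_paths by simp
  next
    case 5
    then show ?thesis using root[of 18] antimagic_cycle_7_with_paths by simp
  next
    case 6
    then show ?thesis using root[of 20] antimagic_cycle_8_with_paths by simp
  next
    case 7
    then show ?thesis using root[of 22] antimagic_cycle_9_with_paths by simp
  qed
qed

section \<open>The value of tau\<close>

lemma tau_eq:
  assumes iff: "\<And>t. antimagic (disjoint_union G (copies t (path 3))) \<longleftrightarrow> int t \<le> b" and "0 \<le> b"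
  shows "tau G = ereal (real_of_int b)"
proof -
  have "antimagic G"
    using iff[of 0] \<open>0 \<le> b\<close> antimagic_disjoint_union_no_copies by simp
  moreover have "(GREATEST t. \<forall>t'\<le>t. antimagic (disjoint_union G (copies t' (path 3)))) = nat b"
    unfolding iff using \<open>0 \<le> b\<close> by (intro Greatest_equality) auto
  ultimately show ?thesis using \<open>0 \<le> b\<close> by (simp add: tau_def)
qed

theorem theorem21:
  fixes n :: nat
  assumes "3 \<le> n" and "n \<le> 9"
  shows "tau (cycle n) = ereal (real_of_int (beta (cycle n))) \<and>
    (\<forall>t::nat. antimagic (disjoint_union (cycle n) (copies t (path 3))) \<longleftrightarrow>
       int t \<le> \<lfloor>(1 + sqrt 2) * (real n + 1 / 2)\<rfloor>)"
proof -
  have iff: "antimagic (disjoint_union (cycle n) (copies t (path 3))) \<longleftrightarrow>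
      int t \<le> \<lfloor>(1 + sqrt 2) * (real n + 1 / 2)\<rfloor>" for t
    unfolding le_floor_iff_quadratic
    using antimagic_cycle_paths_imp_le antimagic_small_cycle_with_paths assms by blast
  moreover have "0 \<le> \<lfloor>(1 + sqrt 2) * (real n + 1 / 2)\<rfloor>" by simp
  ultimately show ?thesis
    using tau_eq beta_cycle[OF assms(1)] by metis
qed

end
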